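(* Let $Z(t)$, $t\in\mathbb{R}^d$, be a non-negative stochastically continuous random field (separable and jointly measurable, defined on a complete probability space) such that (a) $\mathbb{E}\{Z(t)\}=1$ for all $t\in\mathbb{R}^d$; (b) $\mathbb{E}\{\sup_{t\in[0,T]^d}Z(t)\}\in(0,\infty)$ for all $T>0$; (c) for all compact sets $K\subset\mathbb{R}^d$ and all $c\in\mathbb{R}^d$, $\mathbb{E}\{\sup_{t\in K}Z(t+c)\}=\mathbb{E}\{\sup_{t\in K}Z(t)\}$. Then for every $\delta\ge 0$ the constant $$H_Z^\delta=\lim_{T\to\infty}T^{-d}\,\mathbb{E}\Big\{\sup_{t\in[0,T]^d\cap\delta\mathbb{Z}^d}Z(t)\Big\}$$ is well-defined (the limit exists) and finite, and moreover $\lim_{\delta\downarrow 0}H_Z^\delta=H_Z^0$.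
   Context: Convention: for $\delta=0$, $0\mathbb{Z}^d:=\mathbb{R}^d$, so that $H_Z^0=\lim_{T\to\infty}T^{-d}\mathbb{E}\{\sup_{t\in[0,T]^d}Z(t)\}$. For $\delta>0$, $\delta\mathbb{Z}^d=\{\delta k:k\in\mathbb{Z}^d\}$. Standing assumptions: all random fields are defined on a complete probability space $(\Omega,\mathcal{F},\mathbb{P})$, and any stochastically continuous random field is taken to be separable (in the sense of Doob) and jointly measurable. Stochastically continuous means continuous in probability at every $t\in\mathbb{R}^d$. *)

theory Defs
  imports "HOL-Probability.Probability"
begin

definition stochastically_continuous ::
    "'w measure \<Rightarrow> (real^'d \<Rightarrow> 'w \<Rightarrow> real) \<Rightarrow> bool" where
  "stochastically_continuous M Z \<longleftrightarrow>
     (\<forall>t. \<forall>\<epsilon>>0. ((\<lambda>s. measure M {\<omega> \<in> space M. \<bar>Z s \<omega> - Z t \<omega>\<bar> > \<epsilon>}) \<longlongrightarrow> 0) (at t))"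

text \<open>
  Separability in the sense of Doob, with respect to the open sets of the parameter space and
  the closed subsets of the line; the reverse of the displayed inclusion is trivial.
\<close>
definition doob_separable ::
    "'w measure \<Rightarrow> (real^'d \<Rightarrow> 'w \<Rightarrow> real) \<Rightarrow> bool" where
  "doob_separable M Z \<longleftrightarrow>
     (\<exists>D N. countable D \<and> closure D = UNIV \<and> N \<in> null_sets M \<and>
        (\<forall>G C. open G \<longrightarrow> closed C \<longrightarrow>
           {\<omega> \<in> space M. \<forall>t \<in> G \<inter> D. Z t \<omega> \<in> C} - {\<omega> \<in> space M. \<forall>t \<in> G. Z t \<omega> \<in> C} \<subseteq> N))"

definition jointly_measurable ::
    "'w measure \<Rightarrow> (real^'d \<Rightarrow> 'w \<Rightarrow> real) \<Rightarrow> bool" where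
  "jointly_measurable M Z \<longleftrightarrow> (\<lambda>(t, \<omega>). Z t \<omega>) \<in> borel_measurable (borel \<Otimes>\<^sub>M M)"

text \<open>
  The expectation of the supremum over \<open>A\<close> of a non-negative field. The supremum is taken
  in the extended half-line, so it is correct where the paths are unbounded. For a jointly
  measurable field over a complete probability space and a Borel set \<open>A\<close> the supremum is a
  measurable function of \<open>\<omega>\<close> (measurable projection), so that the integral below is its
  Lebesgue integral.
\<close>
definition expected_sup ::
    "'w measure \<Rightarrow> (real^'d \<Rightarrow> 'w \<Rightarrow> real) \<Rightarrow> (real^'d) set \<Rightarrow> ennreal" where
  "expected_sup M Z A = (\<integral>\<^sup>+\<omega>. (SUP t\<in>A. ennreal (Z t \<omega>)) \<partial>M)"

definition scaled_lattice :: "real \<Rightarrow> (real^'d) set" where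
  "scaled_lattice \<delta> = (if \<delta> = 0 then UNIV else {\<delta> *\<^sub>R k | k. \<forall>i. k $ i \<in> \<int>})"

definition mean_sup_rate ::
    "'w measure \<Rightarrow> (real^'d \<Rightarrow> 'w \<Rightarrow> real) \<Rightarrow> real \<Rightarrow> real \<Rightarrow> ennreal" where
  "mean_sup_rate M Z \<delta> T =
     expected_sup M Z (cbox 0 (vec T) \<inter> scaled_lattice \<delta>) / ennreal (T ^ CARD('d))"

text \<open>\<open>Lim\<close> is a definite description: it carries no information unless the limit exists.\<close>
definition H_const :: "'w measure \<Rightarrow> (real^'d \<Rightarrow> 'w \<Rightarrow> real) \<Rightarrow> real \<Rightarrow> ennreal" where
  "H_const M Z \<delta> = Lim at_top (mean_sup_rate M Z \<delta>)"

end

theory Submission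
  imports Defs
begin

text \<open>
  By stationarity the expected supremum over a cube of side \<open>n S\<close> is at most \<open>n\<close> to the power \<open>d\<close>
  times that over a cube of side \<open>S\<close>, on the continuum and on every lattice, so the rates converge
  as in Fekete's lemma. For the limit \<open>\<delta> \<rightarrow> 0\<close>, the cost of replacing a cube by its lattice points
  is subadditive over a tiling by unit cubes, hence bounded per unit volume by the cost on one unit
  cube, uniformly in its position. This cost tends to zero: by stationarity
  \<open>E max (Z s) (Z t)\<close> depends on \<open>t - s\<close> only, and it tends to \<open>1\<close> as \<open>t - s\<close> tends to \<open>0\<close>, by
  continuity in probability and truncation.
\<close>

section \<open>Subadditive functions of cubes\<close>

text \<open>Lengthening the side of a cube by a constant changes its volume by a factor tending to
  \<open>1\<close>. Closed cubes can therefore be compared with slightly larger cells without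
  changing the rate.\<close>

lemma tendsto_cube_ratio_shift:
  fixes h :: "real \<Rightarrow> real"
  assumes "((\<lambda>T. h T / T ^ d) \<longlongrightarrow> L) at_top"
  shows "((\<lambda>T. h (T + a) / T ^ d) \<longlongrightarrow> L) at_top"
proof -
  have f: "filterlim (\<lambda>T::real. T + a) at_top at_top"
    by (subst add.commute, rule filterlim_tendsto_add_at_top[OF tendsto_const filterlim_ident])
  have 1: "((\<lambda>T. h (T + a) / (T + a) ^ d) \<longlongrightarrow> L) at_top"
    by (rule filterlim_compose[OF assms f])
  have "((\<lambda>T::real. 1 + a / T) \<longlongrightarrow> 1 + 0) at_top"
    by (intro tendsto_intros tendsto_divide_0[OF tendsto_const] filterlim_at_top_imp_at_infinity
        filterlim_ident)
  then have "((\<lambda>T::real. (1 + a / T) ^ d) \<longlongrightarrow> (1 + 0) ^ d) at_top"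
    by (rule tendsto_power)
  from tendsto_mult[OF 1 this]
  have 2: "((\<lambda>T. h (T + a) / (T + a) ^ d * (1 + a / T) ^ d) \<longlongrightarrow> L) at_top"
    by simp
  show ?thesis
  proof (rule Lim_transform_eventually[OF 2])
    show "\<forall>\<^sub>F T in at_top. h (T + a) / (T + a) ^ d * (1 + a / T) ^ d = h (T + a) / T ^ d"
      using eventually_gt_at_top[of "max 0 (- a)"]
    proof eventually_elim
      case (elim T)
      then have "1 + a / T = (T + a) / T" by (simp add: field_simps)
      then show ?case using elim by (simp add: power_divide)
    qed
  qed
qed

text \<open>The limit is the infimum of \<open>h S / S ^ d\<close>. Subadditivity is assumed for
  integer multiples of a side only; monotonicity covers the sides in between by rounding up.\<close>

lemma fekete_cube:
  fixes h :: "real \<Rightarrow> real"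
  assumes nonneg: "\<And>T. 0 < T \<Longrightarrow> 0 \<le> h T"
    and mono: "\<And>S T. 0 < S \<Longrightarrow> S \<le> T \<Longrightarrow> h S \<le> h T"
    and sub: "\<And>S n. 0 < S \<Longrightarrow> h (real n * S) \<le> real n ^ d * h S"
  shows "\<exists>L. ((\<lambda>T. h T / T ^ d) \<longlongrightarrow> L) at_top"
proof -
  define X where "X = (\<lambda>S. h S / S ^ d) ` {0<..}"
  define L where "L = Inf X"
  have ne: "X \<noteq> {}" by (auto simp: X_def)
  have pos: "0 \<le> x" if "x \<in> X" for x using that nonneg by (auto simp: X_def)
  have bdd: "bdd_below X" using pos by (intro bdd_belowI[of _ 0]) auto
  have lower: "L \<le> h T / T ^ d" if "0 < T" for T
    unfolding L_def by (rule cInf_lower[OF _ bdd]) (use that in \<open>auto simp: X_def\<close>)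
  have "((\<lambda>T. h T / T ^ d) \<longlongrightarrow> L) at_top"
  proof (rule order_tendstoI)
    fix a assume "a < L"
    then show "\<forall>\<^sub>F T in at_top. a < h T / T ^ d"
      using lower by (intro eventually_mono[OF eventually_gt_at_top[of 0]]) force
  next
    fix a assume "L < a"
    then obtain S where S: "0 < S" "h S / S ^ d < a"
      using cInf_lessD[OF ne, of a] by (auto simp: L_def X_def)
    \<comment> \<open>Rounding \<open>T\<close> up to a multiple of the near-optimal side
      \<open>S\<close> takes at most \<open>T / S + 1\<close> copies of \<open>S\<close> along each
      axis. After division by \<open>T\<close> this leaves \<open>1 / S + 1 / T\<close>.\<close>
    have "((\<lambda>T::real. 1 / S + 1 / T) \<longlongrightarrow> 1 / S + 0) at_top"
      by (intro tendsto_intros tendsto_divide_0[OF tendsto_const] filterlim_at_top_imp_at_infinity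
          filterlim_ident)
    then have "((\<lambda>T::real. (1 / S + 1 / T) ^ d * h S) \<longlongrightarrow> (1 / S + 0) ^ d * h S) at_top"
      by (rule tendsto_mult[OF tendsto_power tendsto_const])
    moreover have "(1 / S + 0) ^ d * h S < a"
      using S by (simp add: power_divide)
    ultimately have "\<forall>\<^sub>F T in at_top. (1 / S + 1 / T) ^ d * h S < a"
      by (rule order_tendstoD(2))
    then show "\<forall>\<^sub>F T in at_top. h T / T ^ d < a"
      using eventually_gt_at_top[of 0]
    proof eventually_elim
      case (elim T)
      define n where "n = nat \<lceil>T / S\<rceil>"
      have n: "T / S \<le> real n" "real n \<le> T / S + 1"
        using elim S divide_pos_pos[of T S] unfolding n_def by linarith+
      have "h T \<le> h (real n * S)"
        using n(1) S elim by (intro mono) (simp_all only: pos_divide_le_eq)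
      also have "\<dots> \<le> real n ^ d * h S" by (rule sub[OF S(1)])
      also have "\<dots> \<le> (T / S + 1) ^ d * h S"
        using n nonneg[OF S(1)] by (intro mult_right_mono power_mono) auto
      finally have "h T / T ^ d \<le> (T / S + 1) ^ d * h S / T ^ d"
        using elim by (intro divide_right_mono) auto
      also have "\<dots> = ((T / S + 1) / T) ^ d * h S" by (simp add: power_divide)
      also have "(T / S + 1) / T = 1 / S + 1 / T" using elim S by (simp add: field_simps)
      finally show ?case using elim by linarith
    qed
  qed
  then show ?thesis by blast
qed

section \<open>Half-open cubes and the lattice\<close>

text \<open>The upper faces are left out so that each point of a finite subset has room to be
  rounded up to a lattice point of the same cell when the mesh is small.\<close>

definition cell :: "real^'d \<Rightarrow> real \<Rightarrow> (real^'d) set" where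
  "cell c T = {x. \<forall>i. c $ i \<le> x $ i \<and> x $ i < c $ i + T}"

lemma cell_mono: "S \<le> T \<Longrightarrow> cell c S \<subseteq> cell c T"
  by (auto simp: cell_def intro: order.strict_trans2)

lemma cell_subset_cbox: "cell 0 T \<subseteq> cbox 0 (vec T)"
  by (auto simp: cell_def mem_box_cart) (meson less_imp_le)

lemma cell_multiple_eq:
  assumes "0 < S"
  shows "cell (0::real^'d) (real n * S) =
    (\<Union>k\<in>(UNIV :: 'd set) \<rightarrow>\<^sub>E {..<n}. cell (\<chi> i. S * real (k i)) S)"
proof (intro equalityI subsetI)
  fix x :: "real^'d" assume x: "x \<in> cell 0 (real n * S)"
  define k where "k i = nat \<lfloor>x $ i / S\<rfloor>" for i
  have k: "real (k i) \<le> x $ i / S" "x $ i / S < real (k i) + 1" for i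
    using x assms by (auto simp: cell_def k_def)
  have "k i < n" for i
  proof -
    have "x $ i < real n * S" using x by (simp add: cell_def)
    then have "x $ i / S < real n" using assms by (simp add: pos_divide_less_eq)
    then show ?thesis using k(1)[of i] by linarith
  qed
  moreover have "x \<in> cell (\<chi> i. S * real (k i)) S"
    using k assms by (auto simp: cell_def field_simps)
  ultimately show "x \<in> (\<Union>k\<in>(UNIV :: 'd set) \<rightarrow>\<^sub>E {..<n}. cell (\<chi> i. S * real (k i)) S)"
    by auto
next
  fix x :: "real^'d"
  assume "x \<in> (\<Union>k\<in>(UNIV :: 'd set) \<rightarrow>\<^sub>E {..<n}. cell (\<chi> i. S * real (k i)) S)"
  then obtain k where k: "\<And>i. k i < n"
    and x: "\<And>i. S * real (k i) \<le> x $ i" "\<And>i. x $ i < S * real (k i) + S"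
    by (fastforce simp: cell_def)
  show "x \<in> cell 0 (real n * S)"
    unfolding cell_def
  proof (intro CollectI allI conjI)
    fix i
    show "(0::real^'d) $ i \<le> x $ i"
      using x(1)[of i] assms by (simp add: order.trans[rotated])
    have "S * real (k i) + S = S * (real (k i) + 1)" by (simp add: field_simps)
    also have "\<dots> \<le> S * real n" using k[of i] assms by (intro mult_left_mono) auto
    finally show "x $ i < (0::real^'d) $ i + real n * S"
      using x(2)[of i] by (simp add: mult.commute)
  qed
qed

lemma card_cell_index: "card ((UNIV :: 'd::finite set) \<rightarrow>\<^sub>E {..<n}) = n ^ CARD('d)"
  by (simp add: card_PiE)

lemma scaled_lattice_0 [simp]: "scaled_lattice 0 = UNIV"
  by (simp add: scaled_lattice_def)

lemma scaled_lattice_diff: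
  assumes "x \<in> scaled_lattice \<delta>" "y \<in> scaled_lattice \<delta>"
  shows "x - y \<in> scaled_lattice \<delta>"
proof (cases "\<delta> = 0")
  case False
  then obtain j k where "x = \<delta> *\<^sub>R j" "y = \<delta> *\<^sub>R k" "\<forall>i. j $ i \<in> \<int>" "\<forall>i. k $ i \<in> \<int>"
    using assms by (auto simp: scaled_lattice_def)
  then have "x - y = \<delta> *\<^sub>R (j - k)" "\<forall>i. (j - k) $ i \<in> \<int>"
    by (auto simp: scaleR_diff_right)
  then show ?thesis using False by (auto simp: scaled_lattice_def)
qed simp

text \<open>Coordinatewise rounding up to the lattice, and the identity for mesh \<open>0\<close>.
  Closeness to \<open>x\<close> serves the approximation by lattice points; minimality serves to
  move the corner of an arbitrary cell onto the lattice.\<close>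

lemma lattice_ceiling:
  fixes x :: "real^'d"
  assumes "0 \<le> \<delta>"
  obtains y where "y \<in> scaled_lattice \<delta>" "\<And>i. x $ i \<le> y $ i" "\<And>i. y $ i \<le> x $ i + \<delta>"
    "\<And>z i. z \<in> scaled_lattice \<delta> \<Longrightarrow> x $ i \<le> z $ i \<Longrightarrow> y $ i \<le> z $ i"
proof (cases "\<delta> = 0")
  case True
  then show ?thesis using that[of x] by simp
next
  case False
  with assms have d: "0 < \<delta>" by simp
  define y where "y = (\<chi> i. \<delta> * of_int \<lceil>x $ i / \<delta>\<rceil>)"
  show ?thesis
  proof (rule that[of y])
    have "y = \<delta> *\<^sub>R (\<chi> i. of_int \<lceil>x $ i / \<delta>\<rceil>)" by (simp add: y_def vec_eq_iff)
    then show "y \<in> scaled_lattice \<delta>"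
      using d by (auto simp: scaled_lattice_def)
  next
    fix i
    have "x $ i / \<delta> \<le> of_int \<lceil>x $ i / \<delta>\<rceil>" by simp
    then have "x $ i \<le> of_int \<lceil>x $ i / \<delta>\<rceil> * \<delta>" using d by (simp only: pos_divide_le_eq)
    then show "x $ i \<le> y $ i" by (simp add: y_def mult.commute)
    have "of_int \<lceil>x $ i / \<delta>\<rceil> \<le> x $ i / \<delta> + 1" by linarith
    then have "\<delta> * of_int \<lceil>x $ i / \<delta>\<rceil> \<le> \<delta> * (x $ i / \<delta> + 1)"
      using d by (intro mult_left_mono) auto
    then show "y $ i \<le> x $ i + \<delta>" using d by (simp add: y_def distrib_left)
  next
    fix z :: "real^'d" and i
    assume "z \<in> scaled_lattice \<delta>" "x $ i \<le> z $ i"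
    then obtain k where k: "z = \<delta> *\<^sub>R k" "k $ i \<in> \<int>"
      using d by (auto simp: scaled_lattice_def)
    then obtain m where m: "k $ i = of_int m" by (auto elim: Ints_cases)
    have "x $ i / \<delta> \<le> of_int m" using \<open>x $ i \<le> z $ i\<close> k m d by (simp add: field_simps)
    then have "\<lceil>x $ i / \<delta>\<rceil> \<le> m" by (simp add: ceiling_le_iff)
    then show "y $ i \<le> z $ i" using d k m by (simp add: y_def)
  qed
qed

lemma finite_cbox_Int_scaled_lattice:
  fixes a b :: "real^'d"
  assumes "0 < \<delta>"
  shows "finite (cbox a b \<inter> scaled_lattice \<delta>)"
proof -
  let ?J = "\<lambda>i. {\<lfloor>a $ i / \<delta>\<rfloor>..\<lceil>b $ i / \<delta>\<rceil>}"
  have "cbox a b \<inter> scaled_lattice \<delta> \<subseteq>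
    (\<lambda>k. \<chi> i. \<delta> * of_int (k i)) ` (PiE UNIV ?J)"
  proof
    fix x assume x: "x \<in> cbox a b \<inter> scaled_lattice \<delta>"
    then obtain k where k: "x = \<delta> *\<^sub>R k" "\<forall>i. k $ i \<in> \<int>"
      using assms by (auto simp: scaled_lattice_def)
    have m: "of_int \<lfloor>k $ i\<rfloor> = k $ i" for i using k(2) by (simp add: of_int_floor)
    have ab: "a $ i / \<delta> \<le> k $ i" "k $ i \<le> b $ i / \<delta>" for i
      using x k assms by (auto simp: mem_box_cart field_simps)
    have "(\<lambda>i. \<lfloor>k $ i\<rfloor>) \<in> PiE UNIV ?J"
      using floor_mono[OF ab(1)] order.trans[OF floor_mono[OF ab(2)] floor_le_ceiling] by auto
    moreover have "x = (\<chi> i. \<delta> * of_int \<lfloor>k $ i\<rfloor>)" using k m by (simp add: vec_eq_iff)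
    ultimately show "x \<in> (\<lambda>k. \<chi> i. \<delta> * of_int (k i)) ` (PiE UNIV ?J)"
      by - (rule image_eqI)
  qed
  then show ?thesis by (rule finite_subset) (intro finite_imageI finite_PiE, auto)
qed

section \<open>Suprema over finite sets\<close>

text \<open>If the supremum of \<open>a\<close> is reached at \<open>i\<close>, passing from
  \<open>a\<close> to \<open>b\<close> lowers the supremum by at most \<open>a i - b i\<close>,
  hence by at most the sum of all such gaps. The additive form avoids differences of possibly
  infinite values.\<close>

lemma SUP_add_sum_exchange:
  fixes a b :: "'i \<Rightarrow> ennreal"
  assumes "finite I" and le: "\<And>i. i \<in> I \<Longrightarrow> b i \<le> a i"
  shows "(SUP i\<in>I. a i) + (\<Sum>i\<in>I. b i) \<le> (SUP i\<in>I. b i) + (\<Sum>i\<in>I. a i)"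
proof (cases "I = {}")
  case False
  have "a i + (\<Sum>i\<in>I. b i) \<le> (SUP i\<in>I. b i) + (\<Sum>i\<in>I. a i)" if i: "i \<in> I" for i
  proof -
    have "a i + (\<Sum>i\<in>I. b i) = b i + (a i + (\<Sum>i\<in>I - {i}. b i))"
      using assms(1) i by (simp add: sum.remove[of I i] ac_simps)
    also have "\<dots> \<le> (SUP i\<in>I. b i) + (a i + (\<Sum>i\<in>I - {i}. a i))"
      using i le by (intro add_mono sum_mono SUP_upper) auto
    also have "\<dots> = (SUP i\<in>I. b i) + (\<Sum>i\<in>I. a i)"
      using assms(1) i by (simp add: sum.remove[of I i])
    finally show ?thesis .
  qed
  then have "(SUP i\<in>I. a i + (\<Sum>i\<in>I. b i)) \<le> (SUP i\<in>I. b i) + (\<Sum>i\<in>I. a i)"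
    by (rule SUP_least)
  then show ?thesis using False by (simp add: ennreal_SUP_add_left)
qed simp

section \<open>Expected suprema of a stationary field\<close>

locale stationary_sup_field = prob_space M
  for M :: "'w measure" and Z :: "real^'d \<Rightarrow> 'w \<Rightarrow> real" +
  assumes Z_measurable [measurable]: "Z t \<in> borel_measurable M"
    and Z_nonneg: "\<omega> \<in> space M \<Longrightarrow> 0 \<le> Z t \<omega>"
    and Z_mean: "expectation (Z t) = 1"
    and Z_shift: "compact K \<Longrightarrow> expected_sup M (\<lambda>t. Z (t + c)) K = expected_sup M Z K"
begin

lemma Z_integrable: "integrable M (Z t)"
  \<comment> \<open>The integral of a non-integrable function is \<open>0\<close> by convention, so
    mean \<open>1\<close> forces integrability.\<close>
  using Z_mean[of t] not_integrable_integral_eq[of M "Z t"] by fastforce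

lemma sup_measurable:
  "countable A \<Longrightarrow> (\<lambda>\<omega>. SUP t\<in>A. ennreal (Z t \<omega>)) \<in> borel_measurable M"
  by (intro borel_measurable_SUP) auto

lemma expected_sup_mono: "A \<subseteq> B \<Longrightarrow> expected_sup M Z A \<le> expected_sup M Z B"
  unfolding expected_sup_def by (intro nn_integral_mono SUP_subset_mono) auto

lemma expected_sup_singleton: "expected_sup M Z {t} = 1"
  using nn_integral_eq_integral[OF Z_integrable[of t]] Z_nonneg Z_mean[of t]
  by (simp add: expected_sup_def)

lemma expected_sup_translate:
  assumes "compact K"
  shows "expected_sup M Z ((+) c ` K) = expected_sup M Z K"
  using Z_shift[OF assms, of c] by (simp add: expected_sup_def image_image add.commute)

text \<open>The pointwise exchange inequality, integrated. It yields subadditivity, the cost of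
  moving points, and the additivity of discretisation errors over cells.\<close>

lemma expected_sup_exchange:
  assumes "finite I" "\<And>i. i \<in> I \<Longrightarrow> finite (A i)" "\<And>i. i \<in> I \<Longrightarrow> B i \<subseteq> A i"
  shows "expected_sup M Z (\<Union>i\<in>I. A i) + (\<Sum>i\<in>I. expected_sup M Z (B i)) \<le>
    expected_sup M Z (\<Union>i\<in>I. B i) + (\<Sum>i\<in>I. expected_sup M Z (A i))"
proof -
  have fB: "finite (B i)" if "i \<in> I" for i using assms(2,3)[OF that] by (rule rev_finite_subset)
  let ?s = "\<lambda>A \<omega>. SUP t\<in>A. ennreal (Z t \<omega>)"
  have [measurable]: "?s (A i) \<in> borel_measurable M" "?s (B i) \<in> borel_measurable M"
    if "i \<in> I" for i
    using assms(2)[OF that] fB[OF that] by (auto intro!: sup_measurable countable_finite)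
  have [measurable]: "?s (\<Union>i\<in>I. A i) \<in> borel_measurable M" "?s (\<Union>i\<in>I. B i) \<in> borel_measurable M"
    using assms(1,2) fB by (auto intro!: sup_measurable countable_finite)
  have "expected_sup M Z (\<Union>i\<in>I. A i) + (\<Sum>i\<in>I. expected_sup M Z (B i)) =
      (\<integral>\<^sup>+\<omega>. ?s (\<Union>i\<in>I. A i) \<omega> + (\<Sum>i\<in>I. ?s (B i) \<omega>) \<partial>M)"
    unfolding expected_sup_def by (subst nn_integral_add) (auto simp: nn_integral_sum)
  also have "\<dots> \<le> (\<integral>\<^sup>+\<omega>. ?s (\<Union>i\<in>I. B i) \<omega> + (\<Sum>i\<in>I. ?s (A i) \<omega>) \<partial>M)"
    unfolding SUP_UNION
    by (intro nn_integral_mono SUP_add_sum_exchange assms(1) SUP_subset_mono assms(3) order.refl)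
  also have "\<dots> = expected_sup M Z (\<Union>i\<in>I. B i) + (\<Sum>i\<in>I. expected_sup M Z (A i))"
    unfolding expected_sup_def by (subst nn_integral_add) (auto simp: nn_integral_sum)
  finally show ?thesis .
qed

lemma expected_sup_UN_le:
  assumes "finite I" "\<And>i. i \<in> I \<Longrightarrow> finite (A i)"
  shows "expected_sup M Z (\<Union>i\<in>I. A i) \<le> (\<Sum>i\<in>I. expected_sup M Z (A i))"
  \<comment> \<open>Over the empty set the supremum in the extended half-line is \<open>0\<close>,
    so all terms with \<open>B\<close> vanish.\<close>
  using expected_sup_exchange[where B = "\<lambda>_. {}", OF assms]
  by (simp add: expected_sup_def bot_ennreal)

text \<open>Exchange each pair \<open>{f, \<phi> f}\<close> for the point \<open>\<phi> f\<close>: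
  the pair exceeds the expectation \<open>1\<close> of a single value by at most
  \<open>\<eta>\<close>, so moving the points costs at most \<open>\<eta>\<close> apiece.\<close>

lemma expected_sup_perturb:
  assumes "finite F" and close: "\<And>f. f \<in> F \<Longrightarrow> expected_sup M Z {f, \<phi> f} \<le> 1 + ennreal \<eta>"
  shows "expected_sup M Z F \<le> expected_sup M Z (\<phi> ` F) + of_nat (card F) * ennreal \<eta>"
proof -
  let ?N = "of_nat (card F) :: ennreal"
  have "?N + expected_sup M Z F \<le> ?N + expected_sup M Z (\<Union>f\<in>F. {f, \<phi> f})"
    by (intro add_left_mono expected_sup_mono) auto
  also have "\<dots> \<le> expected_sup M Z (\<Union>f\<in>F. {\<phi> f}) + (\<Sum>f\<in>F. expected_sup M Z {f, \<phi> f})"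
    using expected_sup_exchange[of F "\<lambda>f. {f, \<phi> f}" "\<lambda>f. {\<phi> f}"] assms(1)
    by (simp add: expected_sup_singleton add.commute)
  also have "\<dots> \<le> expected_sup M Z (\<Union>f\<in>F. {\<phi> f}) + (\<Sum>f\<in>F. 1 + ennreal \<eta>)"
    by (intro add_left_mono sum_mono close)
  also have "\<dots> = ?N + (expected_sup M Z (\<phi> ` F) + ?N * ennreal \<eta>)"
    by (simp add: distrib_left ac_simps UNION_singleton_eq_range)
  finally show ?thesis by (simp add: ennreal_add_left_cancel_le)
qed

text \<open>Working with finite subsets avoids the measurability of suprema over uncountable sets.\<close>
definition fin_sup :: "(real^'d) set \<Rightarrow> ennreal" where
  "fin_sup A = (SUP F\<in>{F. finite F \<and> F \<subseteq> A}. expected_sup M Z F)"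

lemma fin_sup_upper: "finite F \<Longrightarrow> F \<subseteq> A \<Longrightarrow> expected_sup M Z F \<le> fin_sup A"
  unfolding fin_sup_def by (intro SUP_upper) auto

lemma fin_sup_least:
  "(\<And>F. finite F \<Longrightarrow> F \<subseteq> A \<Longrightarrow> expected_sup M Z F \<le> u) \<Longrightarrow> fin_sup A \<le> u"
  unfolding fin_sup_def by (intro SUP_least) auto

lemma fin_sup_mono: "A \<subseteq> B \<Longrightarrow> fin_sup A \<le> fin_sup B"
  by (intro fin_sup_least fin_sup_upper) auto

lemma fin_sup_le_expected_sup: "fin_sup A \<le> expected_sup M Z A"
  by (intro fin_sup_least expected_sup_mono)

lemma fin_sup_translate_le: "fin_sup ((+) c ` A) \<le> fin_sup A"
proof (rule fin_sup_least)
  fix F assume F: "finite F" "F \<subseteq> (+) c ` A"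
  have "expected_sup M Z F = expected_sup M Z ((+) (- c) ` F)"
    \<comment> \<open>Stationarity is stated for compact sets, and finite sets are compact.\<close>
    by (rule expected_sup_translate[symmetric]) (use F in \<open>simp add: finite_imp_compact\<close>)
  also have "\<dots> \<le> fin_sup A" using F by (intro fin_sup_upper) auto
  finally show "expected_sup M Z F \<le> fin_sup A" .
qed

lemma fin_sup_UN_le:
  assumes "finite I"
  shows "fin_sup (\<Union>i\<in>I. A i) \<le> (\<Sum>i\<in>I. fin_sup (A i))"
proof (rule fin_sup_least)
  fix F assume F: "finite F" "F \<subseteq> (\<Union>i\<in>I. A i)"
  have "expected_sup M Z F \<le> expected_sup M Z (\<Union>i\<in>I. F \<inter> A i)"
    using F by (intro expected_sup_mono) auto
  also have "\<dots> \<le> (\<Sum>i\<in>I. expected_sup M Z (F \<inter> A i))"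
    using F assms by (intro expected_sup_UN_le) auto
  also have "\<dots> \<le> (\<Sum>i\<in>I. fin_sup (A i))"
    using F by (intro sum_mono fin_sup_upper) auto
  finally show "expected_sup M Z F \<le> (\<Sum>i\<in>I. fin_sup (A i))" .
qed

text \<open>Monotone convergence along the initial segments of an enumeration.\<close>

lemma expected_sup_countable:
  assumes "countable A"
  shows "expected_sup M Z A = fin_sup A"
proof (rule antisym[OF _ fin_sup_le_expected_sup])
  show "expected_sup M Z A \<le> fin_sup A"
  proof (cases "A = {}")
    case False
    let ?F = "\<lambda>n. from_nat_into A ` {..n}"
    have A: "A = (\<Union>n. ?F n)"
      unfolding image_UN[symmetric] UN_atMost_UNIV by (rule range_from_nat_into[OF False assms, symmetric])
    have "expected_sup M Z A = (\<integral>\<^sup>+\<omega>. (SUP n. SUP t\<in>?F n. ennreal (Z t \<omega>)) \<partial>M)"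
      unfolding expected_sup_def by (subst A) (simp add: SUP_UNION)
    also have "\<dots> = (SUP n. expected_sup M Z (?F n))"
      unfolding expected_sup_def
    proof (rule nn_integral_monotone_convergence_SUP)
      show "incseq (\<lambda>n \<omega>. SUP t\<in>?F n. ennreal (Z t \<omega>))"
        by (intro incseq_SucI le_funI SUP_subset_mono) auto
    qed (auto intro!: sup_measurable)
    also have "\<dots> \<le> fin_sup A"
      using from_nat_into[OF False] by (intro SUP_least fin_sup_upper) auto
    finally show ?thesis .
  qed (simp add: expected_sup_def bot_ennreal)
qed

text \<open>Let \<open>r\<close> be the supremum of a path over \<open>G \<inter> D\<close>.
  Separability for the closed set \<open>{..r}\<close> extends the bound \<open>r\<close> to all of
  \<open>G\<close> outside a null set, which reduces the supremum to a countable set.\<close>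

lemma expected_sup_open:
  assumes "doob_separable M Z" "open G"
  shows "expected_sup M Z G \<le> fin_sup G"
proof -
  obtain D N where D: "countable D" and N: "N \<in> null_sets M"
    and sep: "\<forall>G C. open G \<longrightarrow> closed C \<longrightarrow>
      {\<omega> \<in> space M. \<forall>t \<in> G \<inter> D. Z t \<omega> \<in> C} - {\<omega> \<in> space M. \<forall>t \<in> G. Z t \<omega> \<in> C} \<subseteq> N"
    using assms(1) unfolding doob_separable_def by (elim exE conjE) (rule that)
  note sep = sep[rule_format, OF assms(2)]
  have "AE \<omega> in M. (SUP t\<in>G. ennreal (Z t \<omega>)) \<le> (SUP t\<in>G \<inter> D. ennreal (Z t \<omega>))"
    using AE_not_in[OF N] AE_space[of M]
  proof eventually_elim
    case (elim \<omega>)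
    show ?case
    proof (cases "(SUP t\<in>G \<inter> D. ennreal (Z t \<omega>))")
      case (real r)
      have "Z t \<omega> \<in> {..r}" if "t \<in> G \<inter> D" for t
      proof -
        have "ennreal (Z t \<omega>) \<le> ennreal r"
          unfolding real(2)[symmetric] by (rule SUP_upper[OF that])
        then show ?thesis using real(1) by (simp add: ennreal_le_iff)
      qed
      then have "Z t \<omega> \<in> {..r}" if "t \<in> G" for t
        using sep[of "{..r}"] elim that by blast
      then show ?thesis unfolding real(2) by (intro SUP_least) (auto intro: ennreal_leI)
    next
      case top
      then show ?thesis by (metis top_greatest)
    qed
  qed
  then have "expected_sup M Z G \<le> expected_sup M Z (G \<inter> D)"
    unfolding expected_sup_def by (rule nn_integral_mono_AE)
  also have "\<dots> = fin_sup (G \<inter> D)" using D by (intro expected_sup_countable) auto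
  also have "\<dots> \<le> fin_sup G" by (intro fin_sup_mono) auto
  finally show ?thesis .
qed

section \<open>Uniform continuity in the mean\<close>

lemma truncation_tail_tendsto: "(\<lambda>n. expectation (\<lambda>\<omega>. max 0 (Z t \<omega> - real n))) \<longlonglongrightarrow> 0"
proof -
  have "(\<lambda>n. expectation (\<lambda>\<omega>. max 0 (Z t \<omega> - real n))) \<longlonglongrightarrow> expectation (\<lambda>_. 0)"
  proof (rule integral_dominated_convergence[where w = "Z t"])
    show "AE \<omega> in M. (\<lambda>n. max 0 (Z t \<omega> - real n)) \<longlonglongrightarrow> 0"
    proof (rule AE_I2)
      fix \<omega>
      obtain n0 :: nat where n0: "Z t \<omega> \<le> real n0" using real_arch_simple by blast
      show "(\<lambda>n. max 0 (Z t \<omega> - real n)) \<longlonglongrightarrow> 0"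
        by (rule tendsto_eventually) (use n0 in \<open>auto simp: eventually_sequentially intro!: exI[of _ n0]\<close>)
    qed
  qed (auto simp: Z_integrable Z_nonneg)
  then show ?thesis by simp
qed

text \<open>Translation takes the pair to \<open>{0, t - s}\<close>, so one radius serves all
  positions. Near the origin the maximum is controlled by continuity in probability where
  \<open>Z 0\<close> is below a level \<open>n\<close>, and by the integrable tail above it.\<close>

lemma expected_sup_pair_le:
  assumes sc: "stochastically_continuous M Z" and "0 < \<eta>"
  shows "\<exists>r>0. \<forall>s t. dist s t < r \<longrightarrow> expected_sup M Z {s, t} \<le> 1 + ennreal \<eta>"
proof -
  \<comment> \<open>Three errors are to be absorbed: the oscillation off \<open>?A s\<close>, the
    level \<open>n\<close> on \<open>?A s\<close>, and the tail of \<open>Z 0\<close> above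
    \<open>n\<close>.\<close>
  define \<epsilon> where "\<epsilon> = \<eta> / 3"
  have \<epsilon>: "0 < \<epsilon>" using assms by (simp add: \<epsilon>_def)
  obtain n where n: "expectation (\<lambda>\<omega>. max 0 (Z 0 \<omega> - real n)) < \<epsilon>"
    using order_tendstoD(2)[OF truncation_tail_tendsto \<epsilon>, of 0]
    by (auto simp: eventually_sequentially)
  let ?A = "\<lambda>s. {\<omega> \<in> space M. \<bar>Z s \<omega> - Z 0 \<omega>\<bar> > \<epsilon>}"
  let ?\<tau> = "\<lambda>\<omega>. max 0 (Z 0 \<omega> - real n)"
  have "((\<lambda>s. measure M (?A s)) \<longlongrightarrow> 0) (at 0)"
    using sc \<epsilon> by (simp add: stochastically_continuous_def)
  moreover have "0 < \<epsilon> / (real n + 1)" using \<epsilon> by simp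
  ultimately have "\<forall>\<^sub>F s in at 0. measure M (?A s) < \<epsilon> / (real n + 1)"
    by (rule order_tendstoD(2))
  then obtain r where r: "0 < r"
    "\<And>s. s \<noteq> 0 \<Longrightarrow> dist s 0 < r \<Longrightarrow> measure M (?A s) < \<epsilon> / (real n + 1)"
    by (auto simp: eventually_at)
  have int\<tau>: "integrable M ?\<tau>"
    using Z_integrable[of 0] by (rule Bochner_Integration.integrable_bound) (auto simp: Z_nonneg)
  have near0: "expected_sup M Z {0, s} \<le> 1 + ennreal \<eta>" if "dist s 0 < r" for s
  proof (cases "s = 0")
    case True
    then show ?thesis by (simp add: expected_sup_singleton)
  next
    case False
    \<comment> \<open>This dominates both values: off \<open>?A s\<close>, \<open>Z 0\<close> is at
      most \<open>Z s + \<epsilon>\<close>; on \<open>?A s\<close>, \<open>Z 0\<close> is at most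
      \<open>n\<close> plus its tail.\<close>
    let ?g = "\<lambda>\<omega>. Z s \<omega> + \<epsilon> + real n * indicator (?A s) \<omega> + ?\<tau> \<omega>"
    have indA: "integrable M (indicator (?A s) :: 'w \<Rightarrow> real)"
      by (simp add: integrable_indicator_iff emeasure_eq_measure)
    have intg: "integrable M ?g"
      using Z_integrable int\<tau> indA by (intro Bochner_Integration.integrable_add) auto
    have "real n * measure M (?A s) \<le> real n * (\<epsilon> / (real n + 1))"
      using r(2)[OF False that] by (intro mult_left_mono) auto
    also have "\<dots> \<le> \<epsilon>" using \<epsilon> by (simp add: field_simps)
    finally have P: "real n * measure M (?A s) \<le> \<epsilon>" .
    have "expected_sup M Z {0, s} \<le> (\<integral>\<^sup>+\<omega>. ennreal (?g \<omega>) \<partial>M)"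
      unfolding expected_sup_def
    proof (intro nn_integral_mono SUP_least)
      fix \<omega> t assume \<omega>: "\<omega> \<in> space M" and t: "t \<in> {0, s}"
      have "Z t \<omega> \<le> ?g \<omega>"
        using t \<omega> Z_nonneg[OF \<omega>, of s] \<epsilon> by (auto split: split_indicator)
      then show "ennreal (Z t \<omega>) \<le> ennreal (?g \<omega>)" by (rule ennreal_leI)
    qed
    also have "\<dots> = ennreal (expectation ?g)"
      using intg Z_nonneg \<epsilon> by (intro nn_integral_eq_integral) auto
    also have "expectation ?g = 1 + \<epsilon> + real n * measure M (?A s) + expectation ?\<tau>"
      using Z_integrable int\<tau> indA by (simp add: Z_mean prob_space)
    also have "ennreal \<dots> \<le> ennreal (1 + \<eta>)"
      using P n by (intro ennreal_leI) (simp add: \<epsilon>_def)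
    finally show ?thesis using assms(2) by (simp add: ennreal_plus)
  qed
  have "expected_sup M Z {s, t} \<le> 1 + ennreal \<eta>" if "dist s t < r" for s t
  proof -
    have "expected_sup M Z {s, t} = expected_sup M Z ((+) s ` {0, t - s})" by simp
    also have "\<dots> = expected_sup M Z {0, t - s}" by (rule expected_sup_translate) simp
    also have "\<dots> \<le> 1 + ennreal \<eta>"
      using that by (intro near0) (simp add: dist_norm norm_minus_commute)
    finally show ?thesis .
  qed
  with r(1) show ?thesis by blast
qed

section \<open>Growth over cubes\<close>

text \<open>Mesh \<open>0\<close> gives the whole cell, so the continuum and the lattices share one
  subadditivity argument.\<close>

definition cube_sup :: "real \<Rightarrow> real \<Rightarrow> ennreal" where
  "cube_sup \<delta> T = fin_sup (cell 0 T \<inter> scaled_lattice \<delta>)"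

text \<open>The corner \<open>c\<close> may lie off the lattice. Subtracting the least lattice point
  \<open>y\<close> above it maps the lattice points of the cell into those of the cell at the
  origin, possibly not onto, hence an inequality only.\<close>

lemma fin_sup_cell_le:
  assumes "0 \<le> \<delta>"
  shows "fin_sup (cell c T \<inter> scaled_lattice \<delta>) \<le> cube_sup \<delta> T"
proof -
  obtain y where y: "y \<in> scaled_lattice \<delta>" "\<And>i. c $ i \<le> y $ i"
    "\<And>z i. z \<in> scaled_lattice \<delta> \<Longrightarrow> c $ i \<le> z $ i \<Longrightarrow> y $ i \<le> z $ i"
    using lattice_ceiling[OF assms, of c] by metis
  have "cell c T \<inter> scaled_lattice \<delta> \<subseteq> (+) y ` (cell 0 T \<inter> scaled_lattice \<delta>)"
  proof
    fix x assume x: "x \<in> cell c T \<inter> scaled_lattice \<delta>"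
    have "0 \<le> (x - y) $ i \<and> (x - y) $ i < T" for i
    proof -
      have "c $ i \<le> x $ i" "x $ i < c $ i + T" using x by (auto simp: cell_def)
      then show ?thesis using y(2)[of i] y(3)[of x i] x by auto
    qed
    then have "x - y \<in> cell 0 T \<inter> scaled_lattice \<delta>"
      using x y(1) by (auto simp: cell_def scaled_lattice_diff)
    then show "x \<in> (+) y ` (cell 0 T \<inter> scaled_lattice \<delta>)"
      by (rule rev_image_eqI) simp
  qed
  then show ?thesis
    unfolding cube_sup_def by (rule order.trans[OF fin_sup_mono fin_sup_translate_le])
qed

lemma cube_sup_mono: "S \<le> T \<Longrightarrow> cube_sup \<delta> S \<le> cube_sup \<delta> T"
  unfolding cube_sup_def using cell_mono by (intro fin_sup_mono) blast

lemma cube_sup_le_0: "cube_sup \<delta> T \<le> cube_sup 0 T"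
  unfolding cube_sup_def by (intro fin_sup_mono) auto

text \<open>Tile by cells of side \<open>S\<close> and compare each with the cell at the origin. The
  side need not be a multiple of the mesh.\<close>

lemma cube_sup_multiple:
  assumes "0 \<le> \<delta>" "0 < S"
  shows "cube_sup \<delta> (real n * S) \<le> of_nat n ^ CARD('d) * cube_sup \<delta> S"
proof -
  let ?K = "(UNIV :: 'd set) \<rightarrow>\<^sub>E {..<n}"
  have fin: "finite ?K" by (intro finite_PiE) auto
  have "cube_sup \<delta> (real n * S) =
      fin_sup (\<Union>k\<in>?K. cell (\<chi> i. S * real (k i)) S \<inter> scaled_lattice \<delta>)"
    unfolding cube_sup_def cell_multiple_eq[OF assms(2)] by (simp only: UN_extend_simps)
  also have "\<dots> \<le> (\<Sum>k\<in>?K. fin_sup (cell (\<chi> i. S * real (k i)) S \<inter> scaled_lattice \<delta>))"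
    by (rule fin_sup_UN_le[OF fin])
  also have "\<dots> \<le> (\<Sum>k\<in>?K. cube_sup \<delta> S)"
    by (intro sum_mono fin_sup_cell_le assms)
  also have "\<dots> = of_nat n ^ CARD('d) * cube_sup \<delta> S"
    by (simp add: card_cell_index)
  finally show ?thesis .
qed

lemma cube_sup_le_expected_sup:
  "cube_sup \<delta> T \<le> expected_sup M Z (cbox 0 (vec T) \<inter> scaled_lattice \<delta>)"
  unfolding cube_sup_def
  by (rule order.trans[OF fin_sup_le_expected_sup expected_sup_mono])
    (use cell_subset_cbox in auto)

text \<open>Separability speaks of open sets, so for mesh \<open>0\<close> the closed cube is
  enlarged by \<open>1\<close> on every side, giving side \<open>T + 2\<close>. For positive mesh
  the set is finite and the same bound holds directly.\<close>

lemma expected_sup_le_cube_sup: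
  assumes "doob_separable M Z" "0 \<le> \<delta>"
  shows "expected_sup M Z (cbox 0 (vec T) \<inter> scaled_lattice \<delta>) \<le> cube_sup \<delta> (T + 2)"
proof (cases "\<delta> = 0")
  case True
  let ?c = "vec (-1) :: real^'d"
  have "cbox 0 (vec T) \<subseteq> box ?c (vec (T + 1))"
  proof
    fix x :: "real^'d" assume "x \<in> cbox 0 (vec T)"
    then have "0 \<le> x $ i" "x $ i \<le> T" for i by (auto simp: mem_box_cart)
    then show "x \<in> box ?c (vec (T + 1))"
      by (auto simp: mem_box_cart intro: less_le_trans[of "-1" 0] le_less_trans[of _ T])
  qed
  then have "expected_sup M Z (cbox 0 (vec T)) \<le> expected_sup M Z (box ?c (vec (T + 1)))"
    by (rule expected_sup_mono)
  also have "\<dots> \<le> fin_sup (box ?c (vec (T + 1)))"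
    by (rule expected_sup_open[OF assms(1) open_box])
  also have "\<dots> \<le> fin_sup (cell ?c (T + 2) \<inter> scaled_lattice 0)"
    by (intro fin_sup_mono) (auto simp: cell_def mem_box_cart less_imp_le add.commute)
  also have "\<dots> \<le> cube_sup 0 (T + 2)" by (rule fin_sup_cell_le) simp
  finally show ?thesis using True by simp
next
  case False
  then have "finite (cbox 0 (vec T :: real^'d) \<inter> scaled_lattice \<delta>)"
    using assms(2) by (intro finite_cbox_Int_scaled_lattice) simp
  moreover have "cbox 0 (vec T :: real^'d) \<subseteq> cell 0 (T + 2)"
    by (auto simp: cell_def mem_box_cart intro: le_less_trans[of _ T])
  ultimately show ?thesis unfolding cube_sup_def by (intro fin_sup_upper) auto
qed

section \<open>Comparison of fine lattices with the continuum\<close>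

text \<open>A near-optimal finite set is chosen once in the cell at the origin, translated by
  \<open>c\<close> at no cost, and rounded up to the lattice. The bounds on the mesh depend on that
  set alone, hence the uniformity in \<open>c\<close>.\<close>

lemma lattice_approximates_cell:
  assumes sc: "stochastically_continuous M Z" and fin: "cube_sup 0 1 < \<infinity>" and "0 < \<epsilon>"
  shows "\<forall>\<^sub>F \<delta> in at_right 0. \<forall>c. \<exists>F. finite F \<and> F \<subseteq> cell c 1 \<inter> scaled_lattice \<delta> \<and>
    cube_sup 0 1 \<le> expected_sup M Z F + ennreal \<epsilon>"
proof -
  obtain F where F: "finite F" "F \<subseteq> cell 0 1"
    and Fe: "cube_sup 0 1 < expected_sup M Z F + ennreal (\<epsilon> / 2)"
  proof -
    have "\<exists>F\<in>{F. finite F \<and> F \<subseteq> cell 0 1}. cube_sup 0 1 < expected_sup M Z F + ennreal (\<epsilon> / 2)"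
    proof (rule SUP_approx_ennreal)
      show "cube_sup 0 1 \<noteq> \<infinity>" using fin by simp
    qed (use \<open>0 < \<epsilon>\<close> in \<open>auto simp: cube_sup_def fin_sup_def\<close>)
    then show ?thesis using that by blast
  qed
  \<comment> \<open>Moving all points of \<open>F\<close> then costs at most
    \<open>\<epsilon> / 2\<close>; the added \<open>1\<close> covers an empty
    \<open>F\<close>.\<close>
  define \<eta> where "\<eta> = \<epsilon> / (2 * (real (card F) + 1))"
  have \<eta>: "0 < \<eta>" using \<open>0 < \<epsilon>\<close> by (simp add: \<eta>_def)
  have N\<eta>: "real (card F) * \<eta> \<le> \<epsilon> / 2" using \<open>0 < \<epsilon>\<close> by (simp add: \<eta>_def field_simps)
  obtain r where r: "0 < r"
    "\<And>s t. dist s t < r \<Longrightarrow> expected_sup M Z {s, t} \<le> 1 + ennreal \<eta>"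
    using expected_sup_pair_le[OF sc \<eta>] by blast
  have small: "\<forall>\<^sub>F \<delta> in at_right 0. \<delta> < u" if "0 < u" for u :: real
    using that by (auto simp: eventually_at_right_field)
  \<comment> \<open>The finitely many points lie strictly below the upper faces, so rounding up
    keeps them in the cell.\<close>
  have "\<forall>\<^sub>F \<delta> in at_right 0. \<delta> < 1 - f $ i" if "f \<in> F" for f i
    using that F by (intro small) (auto simp: cell_def)
  then have "\<forall>\<^sub>F \<delta> in at_right 0. \<forall>f\<in>F. \<forall>i. \<delta> < 1 - f $ i"
    using F(1) by (intro eventually_ball_finite ballI eventually_all_finite)
  moreover have "\<forall>\<^sub>F \<delta> in at_right 0. \<delta> < r / CARD('d)" using r(1) by (intro small) simp
  moreover have "\<forall>\<^sub>F \<delta>::real in at_right 0. 0 < \<delta>" by (rule eventually_at_right_less)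
  ultimately show ?thesis
  proof eventually_elim
    case (elim \<delta>)
    show ?case
    proof
      fix c :: "real^'d"
      have "\<forall>x. \<exists>y\<in>scaled_lattice \<delta>. \<forall>i. x $ i \<le> y $ i \<and> y $ i \<le> x $ i + \<delta>" for x :: "real^'d"
        using lattice_ceiling[OF less_imp_le[OF elim(3)]] by metis
      then obtain \<phi> :: "real^'d \<Rightarrow> real^'d" where \<phi>: "\<And>x. \<phi> x \<in> scaled_lattice \<delta>"
        "\<And>x i. x $ i \<le> \<phi> x $ i" "\<And>x i. \<phi> x $ i \<le> x $ i + \<delta>"
        by metis
      have close: "dist x (\<phi> x) < r" for x
      proof -
        have "dist x (\<phi> x) \<le> (\<Sum>i\<in>UNIV. \<bar>(\<phi> x - x) $ i\<bar>)"
          unfolding dist_norm norm_minus_commute[of x] by (rule norm_le_l1_cart)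
        also have "\<dots> \<le> (\<Sum>i\<in>(UNIV :: 'd set). \<delta>)"
          using \<phi>(2,3)[of x] by (intro sum_mono) (simp add: abs_le_iff algebra_simps)
        also have "\<dots> < r" using elim(2) by (simp add: field_simps)
        finally show ?thesis .
      qed
      let ?F = "\<phi> ` (+) c ` F"
      have "?F \<subseteq> cell c 1 \<inter> scaled_lattice \<delta>"
      proof -
        have "c $ i \<le> \<phi> (c + f) $ i \<and> \<phi> (c + f) $ i < c $ i + 1" if "f \<in> F" for f i
        proof -
          have "0 \<le> f $ i" using that F(2) by (auto simp: cell_def)
          moreover have "\<delta> < 1 - f $ i" using elim(1) that by blast
          ultimately show ?thesis using \<phi>(2)[of "c + f" i] \<phi>(3)[of "c + f" i] by simp
        qed
        then show ?thesis using \<phi>(1) by (auto simp: cell_def)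
      qed
      moreover have "cube_sup 0 1 \<le> expected_sup M Z ?F + ennreal \<epsilon>"
      proof -
        have "cube_sup 0 1 \<le> expected_sup M Z ((+) c ` F) + ennreal (\<epsilon> / 2)"
          using Fe F(1) by (simp add: expected_sup_translate finite_imp_compact less_imp_le)
        also have "\<dots> \<le> expected_sup M Z ?F + of_nat (card ((+) c ` F)) * ennreal \<eta> + ennreal (\<epsilon> / 2)"
          using F(1) close by (intro add_right_mono expected_sup_perturb r(2)) auto
        also have "of_nat (card ((+) c ` F)) * ennreal \<eta> = ennreal (real (card F) * \<eta>)"
          using \<eta> by (simp add: card_image ennreal_mult ennreal_of_nat_eq_real_of_nat)
        also have "expected_sup M Z ?F + \<dots> + ennreal (\<epsilon> / 2) \<le>
            expected_sup M Z ?F + ennreal (\<epsilon> / 2) + ennreal (\<epsilon> / 2)"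
          using N\<eta> by (intro add_mono ennreal_leI) auto
        also have "\<dots> = expected_sup M Z ?F + ennreal \<epsilon>"
          using \<open>0 < \<epsilon>\<close> by (simp add: add.assoc flip: ennreal_plus)
        finally show ?thesis .
      qed
      ultimately show "\<exists>F. finite F \<and> F \<subseteq> cell c 1 \<inter> scaled_lattice \<delta> \<and>
          cube_sup 0 1 \<le> expected_sup M Z F + ennreal \<epsilon>"
        using F(1) by (intro exI[of _ ?F]) auto
    qed
  qed
qed

text \<open>
  The discretisation error is subadditive over the unit cells: if the supremum over the large cube
  is reached in one cell, the error is at most the error made in that cell.
\<close>
lemma cube_sup_discretisation:
  assumes fin: "cube_sup 0 1 < \<infinity>"
    and approx: "\<And>c. \<exists>F. finite F \<and> F \<subseteq> cell c 1 \<inter> scaled_lattice \<delta> \<and>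
      cube_sup 0 1 \<le> expected_sup M Z F + ennreal \<epsilon>"
  shows "cube_sup 0 (real n) \<le> cube_sup \<delta> (real n) + of_nat n ^ CARD('d) * ennreal \<epsilon>"
proof -
  let ?K = "(UNIV :: 'd set) \<rightarrow>\<^sub>E {..<n}"
  let ?C = "\<lambda>k. cell (\<chi> i. 1 * real (k i) :: real^'d) 1"
  have finK: "finite ?K" by (intro finite_PiE) auto
  have cells: "cell (0::real^'d) (real n) = (\<Union>k\<in>?K. ?C k)"
    using cell_multiple_eq[of 1 n] by simp
  obtain B where B: "\<And>k. finite (B k)" "\<And>k. B k \<subseteq> ?C k \<inter> scaled_lattice \<delta>"
    "\<And>k. cube_sup 0 1 \<le> expected_sup M Z (B k) + ennreal \<epsilon>"
  proof -
    have "\<forall>k. \<exists>F. finite F \<and> F \<subseteq> ?C k \<inter> scaled_lattice \<delta> \<and>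
        cube_sup 0 1 \<le> expected_sup M Z F + ennreal \<epsilon>"
      using approx by blast
    then show ?thesis using that by (auto dest!: choice)
  qed
  have C_le: "fin_sup (?C k) \<le> cube_sup 0 1" for k
    using fin_sup_cell_le[of 0 "\<chi> i. 1 * real (k i)" 1] by simp
  \<comment> \<open>Finiteness permits the sum over \<open>B k\<close> to be cancelled from both
    sides at the end.\<close>
  have "expected_sup M Z (B k) < \<infinity>" for k
    using fin_sup_upper[OF B(1), of k "?C k"] B(2)[of k] C_le[of k] fin by (auto simp: order.strict_trans1)
  then have Bfin: "(\<Sum>k\<in>?K. expected_sup M Z (B k)) < \<infinity>"
    using finK by (simp add: ennreal_sum_less_top)
  show ?thesis
    unfolding cube_sup_def[of 0]
  proof (rule fin_sup_least)
    fix F :: "(real^'d) set" assume F: "finite F" "F \<subseteq> cell 0 (real n) \<inter> scaled_lattice 0"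
    \<comment> \<open>Adding \<open>B k\<close> provides the inclusion required by the exchange
      inequality while staying inside the cell, so \<open>cube_sup 0 1\<close> still bounds the
      expected supremum.\<close>
    let ?A = "\<lambda>k. (F \<inter> ?C k) \<union> B k"
    have A_le: "expected_sup M Z (?A k) \<le> expected_sup M Z (B k) + ennreal \<epsilon>" for k
      using fin_sup_upper[of "?A k" "?C k"] F B(1)[of k] B(2)[of k] C_le[of k] B(3)[of k]
      by (meson Int_lower2 Un_least finite_Int finite_Un le_infE order.trans)
    have "(\<Sum>k\<in>?K. expected_sup M Z (B k)) + expected_sup M Z F \<le>
        expected_sup M Z (\<Union>k\<in>?K. ?A k) + (\<Sum>k\<in>?K. expected_sup M Z (B k))"
      unfolding add.commute[of _ "expected_sup M Z F"]
    proof (intro add_right_mono expected_sup_mono)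
      show "F \<subseteq> (\<Union>k\<in>?K. ?A k)" using F(2) unfolding cells by blast
    qed
    also have "\<dots> \<le> expected_sup M Z (\<Union>k\<in>?K. B k) + (\<Sum>k\<in>?K. expected_sup M Z (?A k))"
      using F(1) B(1) by (intro expected_sup_exchange finK) auto
    also have "\<dots> \<le> cube_sup \<delta> (real n) +
        (\<Sum>k\<in>?K. expected_sup M Z (B k) + ennreal \<epsilon>)"
      unfolding cube_sup_def cells
      using B(1,2) finK by (intro add_mono sum_mono A_le fin_sup_upper) auto
    also have "\<dots> = (\<Sum>k\<in>?K. expected_sup M Z (B k)) +
        (cube_sup \<delta> (real n) + of_nat n ^ CARD('d) * ennreal \<epsilon>)"
      by (simp add: sum.distrib card_cell_index ac_simps)
    finally show "expected_sup M Z F \<le> cube_sup \<delta> (real n) + of_nat n ^ CARD('d) * ennreal \<epsilon>"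
      using Bfin by (auto simp: ennreal_add_left_cancel_le)
  qed
qed

end

section \<open>Existence of the rates and their limit as the mesh vanishes\<close>

theorem theorem1:
  fixes M :: "'w measure" and Z :: "real^'d \<Rightarrow> 'w \<Rightarrow> real"
  assumes "prob_space M" and "complete_measure M"
    and "\<And>t. Z t \<in> borel_measurable M"
    and "\<And>t \<omega>. \<omega> \<in> space M \<Longrightarrow> 0 \<le> Z t \<omega>"
    and "stochastically_continuous M Z"
    and "doob_separable M Z"
    and "jointly_measurable M Z"
    and "\<And>t. prob_space.expectation M (Z t) = 1"
    and "\<And>T. T > 0 \<Longrightarrow>
           0 < expected_sup M Z (cbox 0 (vec T)) \<and> expected_sup M Z (cbox 0 (vec T)) < \<infinity>"
    and "\<And>K c. compact K \<Longrightarrow> expected_sup M (\<lambda>t. Z (t + c)) K = expected_sup M Z K"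
  shows "(\<forall>\<delta>\<ge>0. (mean_sup_rate M Z \<delta> \<longlongrightarrow> H_const M Z \<delta>) at_top \<and> H_const M Z \<delta> < \<infinity>)
       \<and> (H_const M Z \<longlongrightarrow> H_const M Z 0) (at_right 0)"
proof -
  interpret prob_space M by fact
  interpret stationary_sup_field M Z
    using assms by unfold_locales auto
  \<comment> \<open>Since \<open>enn2real\<close> sends infinity to \<open>0\<close>, the finiteness
    shown next is what makes \<open>h\<close> faithful for positive \<open>T\<close>.\<close>
  define h where "h \<delta> T = enn2real (cube_sup \<delta> T)" for \<delta> T
  let ?d = "CARD('d)"
  have fin: "cube_sup \<delta> T < \<infinity>" if "0 < T" for \<delta> T
    using assms(9)[OF that] cube_sup_le_0[of \<delta> T] cube_sup_le_expected_sup[of 0 T]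
    by (auto simp: order.strict_trans1)
  have h: "ennreal (h \<delta> T) = cube_sup \<delta> T" if "0 < T" for \<delta> T
    using fin[OF that] by (simp add: h_def)
  have h_nonneg: "0 \<le> h \<delta> T" for \<delta> T by (simp add: h_def)
  have h_mono: "h \<delta> S \<le> h \<delta> T" if "0 < S" "S \<le> T" for \<delta> S T
    using that fin[of T] by (auto simp: h_def intro!: enn2real_mono cube_sup_mono)
  have h_le_0: "h \<delta> T \<le> h 0 T" if "0 < T" for \<delta> T
    using that fin[of T] by (auto simp: h_def intro!: enn2real_mono cube_sup_le_0)
  have "h \<delta> (real n * S) \<le> real n ^ ?d * h \<delta> S" if "0 \<le> \<delta>" "0 < S" for \<delta> S n
  proof -
    have "cube_sup \<delta> (real n * S) \<le> ennreal (real n ^ ?d * h \<delta> S)"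
      using cube_sup_multiple[OF that, of n] h[OF that(2)] h_nonneg
      by (simp add: ennreal_mult ennreal_of_nat_eq_real_of_nat flip: ennreal_power)
    then show ?thesis unfolding h_def[of _ "real n * S"]
      using h_nonneg by (intro enn2real_leI) auto
  qed
  then have "\<exists>L. ((\<lambda>T. h \<delta> T / T ^ ?d) \<longlongrightarrow> L) at_top" if "0 \<le> \<delta>" for \<delta>
    using that h_nonneg h_mono by (intro fekete_cube) auto
  then obtain L where L: "\<And>\<delta>. 0 \<le> \<delta> \<Longrightarrow> ((\<lambda>T. h \<delta> T / T ^ ?d) \<longlongrightarrow> L \<delta>) at_top"
    by metis
  \<comment> \<open>The closed cube lies between the cells of sides \<open>T\<close> and
    \<open>T + 2\<close> as far as expected suprema are concerned, and both bounds have the same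
    rate.\<close>
  have rate: "(mean_sup_rate M Z \<delta> \<longlongrightarrow> ennreal (L \<delta>)) at_top" if "0 \<le> \<delta>" for \<delta>
  proof (rule tendsto_sandwich)
    show "((\<lambda>T. ennreal (h \<delta> T / T ^ ?d)) \<longlongrightarrow> ennreal (L \<delta>)) at_top"
      by (intro tendsto_ennrealI L that)
    show "((\<lambda>T. ennreal (h \<delta> (T + 2) / T ^ ?d)) \<longlongrightarrow> ennreal (L \<delta>)) at_top"
      by (intro tendsto_ennrealI tendsto_cube_ratio_shift L that)
    show "\<forall>\<^sub>F T in at_top. ennreal (h \<delta> T / T ^ ?d) \<le> mean_sup_rate M Z \<delta> T"
      using eventually_gt_at_top[of 0]
    proof eventually_elim
      case (elim T)
      then show ?case
        using cube_sup_le_expected_sup[of \<delta> T] h_nonneg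
        by (simp add: mean_sup_rate_def h divide_right_mono_ennreal flip: divide_ennreal)
    qed
    show "\<forall>\<^sub>F T in at_top. mean_sup_rate M Z \<delta> T \<le> ennreal (h \<delta> (T + 2) / T ^ ?d)"
      using eventually_gt_at_top[of 0]
    proof eventually_elim
      case (elim T)
      then show ?case
        using expected_sup_le_cube_sup[OF assms(6) that, of T] h_nonneg
        by (simp add: mean_sup_rate_def h divide_right_mono_ennreal flip: divide_ennreal)
    qed
  qed
  have H: "H_const M Z \<delta> = ennreal (L \<delta>)" if "0 \<le> \<delta>" for \<delta>
    unfolding H_const_def by (rule tendsto_Lim[OF _ rate[OF that]]) simp
  \<comment> \<open>The discretisation bound is available for integer sides, so the limits are
    compared along the integers.\<close>
  have seq: "(\<lambda>n. h \<delta> (real n) / real n ^ ?d) \<longlonglongrightarrow> L \<delta>" if "0 \<le> \<delta>" for \<delta>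
    by (rule filterlim_compose[OF L[OF that] filterlim_real_sequentially])
  have L_le: "L \<delta> \<le> L 0" if "0 \<le> \<delta>" for \<delta>
  proof (rule LIMSEQ_le[OF seq[OF that] seq[OF order.refl]])
    show "\<exists>N. \<forall>n\<ge>N. h \<delta> (real n) / real n ^ ?d \<le> h 0 (real n) / real n ^ ?d"
      by (intro exI[of _ 1] allI impI divide_right_mono h_le_0) auto
  qed
  have lower: "\<forall>\<^sub>F \<delta> in at_right 0. L 0 \<le> L \<delta> + \<epsilon>" if "0 < \<epsilon>" for \<epsilon>
    using lattice_approximates_cell[OF assms(5) fin[OF zero_less_one] that] eventually_at_right_less
  proof eventually_elim
    case (elim \<delta>)
    \<comment> \<open>The error per unit volume does not depend on \<open>n\<close>, so it survives
      the limit in \<open>n\<close> with the mesh fixed.\<close>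
    have "h 0 (real n) / real n ^ ?d \<le> h \<delta> (real n) / real n ^ ?d + \<epsilon>" if "1 \<le> n" for n
    proof -
      have "cube_sup 0 (real n) \<le> cube_sup \<delta> (real n) + of_nat n ^ ?d * ennreal \<epsilon>"
        using elim(1) by (intro cube_sup_discretisation fin) auto
      also have "\<dots> = ennreal (h \<delta> (real n) + real n ^ ?d * \<epsilon>)"
        using that \<open>0 < \<epsilon>\<close> h_nonneg
        by (simp add: h ennreal_plus ennreal_mult ennreal_of_nat_eq_real_of_nat flip: ennreal_power)
      finally have "h 0 (real n) \<le> h \<delta> (real n) + real n ^ ?d * \<epsilon>"
        unfolding h_def[of 0] using h_nonneg \<open>0 < \<epsilon>\<close> by (intro enn2real_leI) auto
      then show ?thesis using that by (simp add: field_simps)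
    qed
    then show ?case
      using elim(2) by (intro LIMSEQ_le[OF seq tendsto_add[OF seq tendsto_const]]) auto
  qed
  have "(L \<longlongrightarrow> L 0) (at_right 0)"
  proof (rule order_tendstoI)
    fix a assume "a < L 0"
    then have "0 < (L 0 - a) / 2" by simp
    from lower[OF this] show "\<forall>\<^sub>F \<delta> in at_right 0. a < L \<delta>"
      by eventually_elim (use \<open>a < L 0\<close> in \<open>simp add: field_simps\<close>)
  next
    fix a assume "L 0 < a"
    then show "\<forall>\<^sub>F \<delta> in at_right 0. L \<delta> < a"
      using L_le eventually_at_right_less[of "0::real"]
      by (auto elim!: eventually_mono intro: order.strict_trans1[OF L_le])
  qed
  then have "((\<lambda>\<delta>. ennreal (L \<delta>)) \<longlongrightarrow> ennreal (L 0)) (at_right 0)"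
    by (rule tendsto_ennrealI)
  then have "(H_const M Z \<longlongrightarrow> H_const M Z 0) (at_right 0)"
    unfolding H[OF order.refl]
    by (rule Lim_transform_eventually)
      (use eventually_at_right_less[of "0::real"] in \<open>auto elim!: eventually_mono simp: H\<close>)
  then show ?thesis using rate H by auto
qed

end
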